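(* Let $k\ge1$ be an integer and let $c>1$ be a constant. For any graph $G$ of order $n$ with minimum degree $\delta\ge ck-1$, $$\gamma_{\times k}(G)<\left(\frac{c}{\delta+1}+\frac{1}{e^{0.5k(c+1/c-2)}}\right)kn .$$
   Context: All graphs are finite, undirected, without loops and multiple edges (and nonempty). $N[v]$ denotes the closed neighbourhood of $v$ (the neighbours of $v$ together with $v$). A set $X\subseteq V(G)$ is a $k$-tuple dominating set of $G$ if $|N[v]\cap X|\ge k$ for every vertex $v\in V(G)$. The $k$-tuple domination number $\gamma_{\times k}(G)$ is the minimum cardinality of a $k$-tuple dominating set of $G$; it is defined for graphs with minimum degree at least $k-1$. *)

theory Defs
  imports Complex_Main "Graph_Theory.Digraph"
begin

text \<open>
  Finite simple graphs are the digraphs satisfying the locale predicate \<^const>\<open>graph\<close>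
  (finite, symmetric, without loops and parallel arcs): each undirected edge is a pair of
  opposite arcs, so the degree of a vertex is its \<^const>\<open>out_degree\<close>. The locale admits the null
  graph, so nonemptiness has to be assumed separately.
\<close>

definition min_degree :: "('a, 'b) pre_digraph \<Rightarrow> nat" where
  "min_degree G = Min (out_degree G ` verts G)"

definition closed_nbhd :: "('a, 'b) pre_digraph \<Rightarrow> 'a \<Rightarrow> 'a set" where
  "closed_nbhd G v = insert v {u. v \<rightarrow>\<^bsub>G\<^esub> u}"

definition tuple_dominating :: "nat \<Rightarrow> ('a, 'b) pre_digraph \<Rightarrow> 'a set \<Rightarrow> bool" where
  "tuple_dominating k G X \<longleftrightarrow>
     X \<subseteq> verts G \<and> (\<forall>v \<in> verts G. k \<le> card (closed_nbhd G v \<inter> X))"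

text \<open>
  The following is meaningful only if the minimum degree is at least \<open>k - 1\<close>, which guarantees
  that the set under \<^const>\<open>Min\<close> is nonempty.
\<close>

definition tuple_domination_number :: "nat \<Rightarrow> ('a, 'b) pre_digraph \<Rightarrow> nat" where
  "tuple_domination_number k G = Min {card X | X. tuple_dominating k G X}"

lemma card_closed_nbhd:
  assumes "graph G"
  shows "card (closed_nbhd G v) = out_degree G v + 1"
proof -
  interpret graph G by fact
  have nb: "{u. v \<rightarrow>\<^bsub>G\<^esub> u} = head G ` out_arcs G v"
    by (auto simp: arcs_ends_conv)
  have "inj_on (head G) (out_arcs G v)"
    by (auto intro!: inj_onI no_multi_arcs simp: arc_to_ends_def)
  then have "card {u. v \<rightarrow>\<^bsub>G\<^esub> u} = out_degree G v"
    by (simp add: nb card_image out_degree_def)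
  moreover have "v \<notin> {u. v \<rightarrow>\<^bsub>G\<^esub> u}"
    using adj_not_same by blast
  moreover have "finite {u. v \<rightarrow>\<^bsub>G\<^esub> u}"
    by (simp add: nb finite_out_arcs)
  ultimately show ?thesis
    by (simp add: closed_nbhd_def)
qed

lemma tuple_dominating_verts:
  assumes "graph G" "k \<le> min_degree G + 1"
  shows "tuple_dominating k G (verts G)"
proof -
  interpret graph G by fact
  have "k \<le> card (closed_nbhd G v \<inter> verts G)" if v: "v \<in> verts G" for v
  proof -
    have "closed_nbhd G v \<inter> verts G = closed_nbhd G v"
      using v by (auto simp: closed_nbhd_def dest: adj_in_verts)
    moreover have "min_degree G \<le> out_degree G v"
      using v by (simp add: min_degree_def)
    ultimately show ?thesis
      using assms card_closed_nbhd[OF assms(1), of v] by simp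
  qed
  then show ?thesis
    by (simp add: tuple_dominating_def)
qed

end

theory Submission
  imports Defs
begin

text \<open>
  The proof is by alteration of a random set. Put \<open>m = \<delta> + 1\<close>, a lower bound for the size of
  every closed neighbourhood, and choose every vertex independently with probability
  \<open>p = c k / m\<close>, which is at most 1 by the hypothesis on \<open>\<delta>\<close>. The chosen set \<open>X\<close> has
  expected size \<open>p n\<close>, the first term of the bound. Each vertex \<open>v\<close> then adds
  \<open>k - card (N[v] \<inter> X)\<close> further vertices of \<open>N[v]\<close> whenever this number is positive, and the
  result is \<open>k\<close>-tuple dominating (lemma \<open>exists_repair\<close>).

  The expected number of additions comes from Chernoff's exponential moment method. The truncated
  difference \<open>k - j\<close> is less than \<open>k c\<^sup>k (1/c)\<^sup>j\<close> (lemma \<open>deficiency_less\<close>), and the factor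
  \<open>(1/c)\<^sup>j\<close> with \<open>j = card (N[v] \<inter> X)\<close> is a product of independent factors, one for each
  vertex of \<open>N[v]\<close>. Its expectation is therefore \<open>(1 - p + p/c)\<close> to the power \<open>card N[v]\<close>, at
  most \<open>exp (- (c k - k))\<close>. Since \<open>ln c \<le> (c - 1/c) / 2\<close>, the product
  \<open>c\<^sup>k exp (- (c k - k))\<close> is at most \<open>exp (- k (c + 1/c - 2) / 2)\<close>, which gives the second term
  (lemma \<open>moment_bound\<close>). The strict inequality is that of the deficiency estimate.

  Neighbourhoods enter only as large subsets of the vertex set, so the argument is carried out for
  an arbitrary family of subsets of a finite set (lemma \<open>exists_multiple_transversal\<close>).
\<close>

section \<open>Independent random choices from a finite set\<close>

text \<open>
  The probability that independent choices with probability \<open>p\<close> from \<open>V\<close> select exactly \<open>X\<close>.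
  All random variables below depend on \<open>X\<close> alone, so expectations are sums over the power set.
\<close>
definition choice_weight :: "real \<Rightarrow> 'a set \<Rightarrow> 'a set \<Rightarrow> real" where
  "choice_weight p V X = p ^ card X * (1 - p) ^ card (V - X)"

text \<open>
  Independence: expanding the product on the right chooses for each element whether it lies in \<open>X\<close>.
\<close>
lemma expectation_product:
  assumes "finite V"
  shows "(\<Sum>X\<in>Pow V. choice_weight p V X * ((\<Prod>u\<in>X. f u) * (\<Prod>u\<in>V - X. g u)))
    = (\<Prod>u\<in>V. p * f u + (1 - p) * g u)"
  unfolding prod_add[OF assms, of "\<lambda>u. p * f u" "\<lambda>u. (1 - p) * g u"]
  by (intro sum.cong) (simp_all add: choice_weight_def prod.distrib)

lemma sum_choice_weight:
  assumes "finite V"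
  shows "(\<Sum>X\<in>Pow V. choice_weight p V X) = 1"
  using expectation_product[OF assms, of p "\<lambda>_. 1" "\<lambda>_. 1"] by simp

lemma choice_weight_nonneg:
  assumes "0 \<le> p" "p \<le> 1"
  shows "0 \<le> choice_weight p V X"
  using assms by (simp add: choice_weight_def)

text \<open>
  The indicator of \<open>v \<in> X\<close> is itself a product, with a factor 0 for \<open>v\<close> if it is not chosen.
\<close>
lemma probability_member:
  assumes "finite V" "v \<in> V"
  shows "(\<Sum>X\<in>Pow V. choice_weight p V X * of_bool (v \<in> X)) = p"
proof -
  let ?g = "\<lambda>u. of_bool (u \<noteq> v) :: real"
  have "(\<Prod>u\<in>V - X. ?g u) = of_bool (v \<in> X)" if "X \<in> Pow V" for X
    using assms by (cases "v \<in> X") (auto intro!: prod.neutral)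
  then have "(\<Sum>X\<in>Pow V. choice_weight p V X * of_bool (v \<in> X))
      = (\<Sum>X\<in>Pow V. choice_weight p V X * ((\<Prod>u\<in>X. 1) * (\<Prod>u\<in>V - X. ?g u)))"
    by (intro sum.cong) simp_all
  also have "\<dots> = (\<Prod>u\<in>V. p * 1 + (1 - p) * ?g u)"
    by (rule expectation_product[OF assms(1)])
  also have "\<dots> = (\<Prod>u\<in>V. if u = v then p else 1)"
    by (intro prod.cong) auto
  also have "\<dots> = p"
    using assms by simp
  finally show ?thesis .
qed

lemma expectation_card:
  assumes "finite V"
  shows "(\<Sum>X\<in>Pow V. choice_weight p V X * real (card X)) = p * real (card V)"
proof -
  have "real (card X) = (\<Sum>v\<in>V. of_bool (v \<in> X))" if "X \<in> Pow V" for X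
    using that assms by (simp add: Int_absorb1)
  then have "(\<Sum>X\<in>Pow V. choice_weight p V X * real (card X))
      = (\<Sum>X\<in>Pow V. \<Sum>v\<in>V. choice_weight p V X * of_bool (v \<in> X))"
    by (intro sum.cong) (simp_all add: sum_distrib_left)
  also have "\<dots> = (\<Sum>v\<in>V. \<Sum>X\<in>Pow V. choice_weight p V X * of_bool (v \<in> X))"
    by (rule sum.swap)
  also have "\<dots> = p * real (card V)"
    using probability_member[OF assms] by simp
  finally show ?thesis .
qed

text \<open>
  This is the probability generating function of the binomially distributed \<open>card (N \<inter> X)\<close>.
\<close>
lemma expectation_power_card_Int:
  assumes "finite V" "N \<subseteq> V"
  shows "(\<Sum>X\<in>Pow V. choice_weight p V X * y ^ card (N \<inter> X)) = (1 - p + p * y) ^ card N"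
proof -
  let ?f = "\<lambda>u. if u \<in> N then y else 1"
  have "(\<Prod>u\<in>X. ?f u) = y ^ card (N \<inter> X)" if "X \<in> Pow V" for X
  proof -
    have "finite X"
      using that assms(1) by (auto intro: finite_subset)
    then show ?thesis
      by (simp add: prod.If_cases Int_commute)
  qed
  then have "(\<Sum>X\<in>Pow V. choice_weight p V X * y ^ card (N \<inter> X))
      = (\<Sum>X\<in>Pow V. choice_weight p V X * ((\<Prod>u\<in>X. ?f u) * (\<Prod>u\<in>V - X. 1)))"
    by (intro sum.cong) simp_all
  also have "\<dots> = (\<Prod>u\<in>V. p * ?f u + (1 - p) * 1)"
    by (rule expectation_product[OF assms(1)])
  also have "\<dots> = (\<Prod>u\<in>V. if u \<in> N then 1 - p + p * y else 1)"
    by (intro prod.cong) (auto simp: algebra_simps)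
  also have "\<dots> = (1 - p + p * y) ^ card N"
    using assms by (simp add: prod.If_cases Int_absorb1)
  finally show ?thesis .
qed

lemma exists_le_expectation:
  assumes "finite V" "0 \<le> p" "p \<le> 1"
    and "(\<Sum>X\<in>Pow V. choice_weight p V X * h X) \<le> B"
  shows "\<exists>X\<subseteq>V. h X \<le> B"
proof (rule ccontr)
  assume "\<not> (\<exists>X\<subseteq>V. h X \<le> B)"
  then have less: "B < h X" if "X \<subseteq> V" for X
    using that not_le by blast
  have nonneg: "0 \<le> choice_weight p V X * (h X - B)" if "X \<in> Pow V" for X
    using less[of X] that
    by (intro mult_nonneg_nonneg choice_weight_nonneg[OF assms(2,3)]) simp
  have "(\<Sum>X\<in>Pow V. choice_weight p V X * (h X - B))
      = (\<Sum>X\<in>Pow V. choice_weight p V X * h X) - (\<Sum>X\<in>Pow V. choice_weight p V X) * B"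
    by (simp only: right_diff_distrib sum_subtractf sum_distrib_right)
  also have "\<dots> \<le> 0"
    using assms(4) sum_choice_weight[OF assms(1)] by simp
  finally have "(\<Sum>X\<in>Pow V. choice_weight p V X * (h X - B)) = 0"
    using sum_nonneg[OF nonneg] by (rule antisym)
  then have product_0: "choice_weight p V X * (h X - B) = 0" if "X \<in> Pow V" for X
    using assms(1) by (intro sum_nonneg_0[OF _ nonneg _ that]) simp_all
  have "choice_weight p V X = 0" if "X \<in> Pow V" for X
    using product_0[OF that] less[of X] that by simp
  then have "(\<Sum>X\<in>Pow V. choice_weight p V X) = 0"
    by simp
  then show False
    using sum_choice_weight[OF assms(1), of p] by simp
qed

section \<open>Repairing a random set\<close>

text \<open>
  A set that meets \<open>N i\<close> in too few elements is repaired inside \<open>N i - X\<close>, which is large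
  enough because \<open>N i\<close> has at least \<open>k\<close> elements. Additions made for different \<open>i\<close> may
  coincide, so the sum of the deficiencies is only an upper bound for their number.
\<close>
lemma exists_repair:
  assumes "finite V" "finite I" "X \<subseteq> V"
    and N: "\<forall>i\<in>I. N i \<subseteq> V \<and> k \<le> card (N i)"
  shows "\<exists>D\<subseteq>V. (\<forall>i\<in>I. k \<le> card (N i \<inter> D))
    \<and> card D \<le> card X + (\<Sum>i\<in>I. k - card (N i \<inter> X))"
proof -
  have "\<exists>A \<subseteq> N i - X. card A = k - card (N i \<inter> X)" if "i \<in> I" for i
  proof -
    have "finite (N i)"
      using bspec[OF N that] assms(1) by (blast intro: finite_subset)
    then have "card (N i) = card (N i \<inter> X) + card (N i - X)"
      by (metis Int_Diff_Un Int_Diff_disjoint card_Un_disjoint finite_Diff finite_Int)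
    then have "k - card (N i \<inter> X) \<le> card (N i - X)"
      using bspec[OF N that] by linarith
    then show ?thesis
      by (metis obtain_subset_with_card_n)
  qed
  then obtain A where A: "\<And>i. i \<in> I \<Longrightarrow> A i \<subseteq> N i - X \<and> card (A i) = k - card (N i \<inter> X)"
    by metis
  let ?D = "X \<union> (\<Union>i\<in>I. A i)"
  show ?thesis
  proof (intro exI[of _ ?D] conjI ballI)
    show "?D \<subseteq> V"
      using assms(3) A N by blast
  next
    fix i assume i: "i \<in> I"
    have fin: "finite (N i)"
      using bspec[OF N i] assms(1) by (blast intro: finite_subset)
    have "finite (A i)"
      using A[OF i] fin by (blast intro: finite_subset)
    then have "k \<le> card ((N i \<inter> X) \<union> A i)"
      using A[OF i] fin by (subst card_Un_disjoint) auto
    also have "\<dots> \<le> card (N i \<inter> ?D)"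
      using A[OF i] i fin by (intro card_mono) auto
    finally show "k \<le> card (N i \<inter> ?D)" .
  next
    have "card ?D \<le> card X + card (\<Union>i\<in>I. A i)"
      by (rule card_Un_le)
    also have "card (\<Union>i\<in>I. A i) \<le> (\<Sum>i\<in>I. card (A i))"
      using assms(2) by (rule card_UN_le)
    also have "\<dots> = (\<Sum>i\<in>I. k - card (N i \<inter> X))"
      using A by (intro sum.cong) simp_all
    finally show "card ?D \<le> card X + (\<Sum>i\<in>I. k - card (N i \<inter> X))"
      by simp
  qed
qed

section \<open>The expected deficiency\<close>

text \<open>
  For \<open>j < k\<close> the exponential factor \<open>c\<^sup>k\<^sup>-\<^sup>j\<close> exceeds 1; otherwise the left side vanishes, whereas
  the right side stays positive.
\<close>
lemma deficiency_less:
  fixes c :: real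
  assumes "c > 1" "k \<ge> 1"
  shows "real (k - j) < real k * c ^ k * (1 / c) ^ j"
proof (cases "j < k")
  case True
  have "real (k - j) \<le> real k"
    by simp
  also have "\<dots> < real k * c ^ (k - j)"
    using assms True by simp
  also have "\<dots> = real k * c ^ k * (1 / c) ^ j"
    using assms True by (simp add: power_diff field_simps)
  finally show ?thesis .
next
  case False
  then show ?thesis
    using assms by simp
qed

text \<open>
  The choice \<open>c k / m\<close> of \<open>p\<close> gives \<open>p (1 - 1/c) m = c k - k\<close>. Comparing exponents leaves
  \<open>ln c \<le> (c - 1/c) / 2\<close>, which is \<open>t \<le> sinh t\<close> at \<open>t = ln c\<close>.
\<close>
lemma moment_bound:
  fixes c :: real
  assumes "c > 1" "c * real k \<le> real m" "m > 0" "m \<le> n" "p = c * real k / real m"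
  shows "c ^ k * (1 - p + p * (1 / c)) ^ n \<le> 1 / exp (0.5 * real k * (c + 1 / c - 2))"
proof -
  have p: "0 \<le> p" "p \<le> 1"
    using assms by simp_all
  have base: "1 - p + p * (1 / c) = 1 - p * (1 - 1 / c)"
    by (simp add: algebra_simps)
  have "p * (1 - 1 / c) \<le> 1 * 1"
    using assms(1) p by (intro mult_mono) auto
  moreover have "0 \<le> p * (1 - 1 / c)"
    using assms(1) p by simp
  ultimately have base_bounds: "0 \<le> 1 - p * (1 - 1 / c)" "1 - p * (1 - 1 / c) \<le> 1"
    by simp_all
  \<comment> \<open>The base is at most 1, so sets larger than \<open>m\<close> only lower the moment.\<close>
  have "(1 - p * (1 - 1 / c)) ^ n \<le> (1 - p * (1 - 1 / c)) ^ m"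
    using base_bounds assms(4) by (intro power_decreasing) auto
  also have "\<dots> \<le> exp (- (p * (1 - 1 / c))) ^ m"
    using exp_ge_add_one_self[of "- (p * (1 - 1 / c))"] base_bounds by (intro power_mono) auto
  also have "\<dots> = exp (- (c * real k - real k))"
    using assms by (simp flip: exp_of_nat_mult) (simp add: field_simps)
  finally have tail: "(1 - p * (1 - 1 / c)) ^ n \<le> exp (- (c * real k - real k))" .
  have "ln c \<le> (c - 1 / c) / 2"
    using real_le_x_sinh[of "ln c"] assms(1) by (simp add: inverse_eq_divide)
  then have "real k * ln c \<le> real k * ((c - 1 / c) / 2)"
    by (intro mult_left_mono) auto
  then have exponent: "real k * ln c - (c * real k - real k) \<le> - (0.5 * real k * (c + 1 / c - 2))"
    by (simp add: algebra_simps) argo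
  have "c ^ k = exp (real k * ln c)"
    using assms(1) by (simp add: exp_of_nat_mult)
  then have "c ^ k * (1 - p * (1 - 1 / c)) ^ n \<le> exp (real k * ln c) * exp (- (c * real k - real k))"
    using tail by simp
  also have "\<dots> = exp (real k * ln c - (c * real k - real k))"
    by (simp flip: exp_add)
  also have "\<dots> \<le> exp (- (0.5 * real k * (c + 1 / c - 2)))"
    using exponent by (simp only: exp_le_cancel_iff)
  also have "\<dots> = 1 / exp (0.5 * real k * (c + 1 / c - 2))"
    by (simp only: exp_minus inverse_eq_divide)
  finally show ?thesis
    by (simp only: base)
qed

section \<open>The domination bound\<close>

text \<open>
  The cost \<open>card X\<close> plus the exponential bounds on the deficiencies has expectation at most the
  right-hand side, so some \<open>X\<close> costs no more than that. Its repair costs strictly less, since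
  the deficiency estimate is strict for every member of the nonempty family.
\<close>
lemma exists_multiple_transversal:
  fixes c :: real and N :: "'i \<Rightarrow> 'a set"
  assumes "finite V" "finite I" "I \<noteq> {}" "k \<ge> 1" "c > 1" "c * real k \<le> real m"
    and N: "\<forall>i\<in>I. N i \<subseteq> V \<and> m \<le> card (N i)"
  shows "\<exists>D\<subseteq>V. (\<forall>i\<in>I. k \<le> card (N i \<inter> D))
    \<and> real (card D) < c * real k / real m * real (card V)
      + real k * (1 / exp (0.5 * real k * (c + 1 / c - 2))) * real (card I)"
proof -
  have "1 * real k \<le> c * real k"
    using assms(5) by (intro mult_right_mono) auto
  then have km: "k \<le> m" and "m > 0"
    using assms(4,6) by linarith+
  define p where "p = c * real k / real m"
  have p: "0 \<le> p" "p \<le> 1"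
    using assms \<open>m > 0\<close> by (simp_all add: p_def)
  let ?q = "1 / exp (0.5 * real k * (c + 1 / c - 2))"
  let ?w = "choice_weight p V"
  let ?h = "\<lambda>X. real (card X) + (\<Sum>i\<in>I. real k * c ^ k * (1 / c) ^ card (N i \<inter> X))"
  have "(\<Sum>X\<in>Pow V. ?w X * ?h X) = (\<Sum>X\<in>Pow V. ?w X * real (card X))
      + (\<Sum>X\<in>Pow V. \<Sum>i\<in>I. real k * c ^ k * (?w X * (1 / c) ^ card (N i \<inter> X)))"
    by (simp add: distrib_left sum.distrib sum_distrib_left mult_ac)
  also have "(\<Sum>X\<in>Pow V. \<Sum>i\<in>I. real k * c ^ k * (?w X * (1 / c) ^ card (N i \<inter> X)))
      = (\<Sum>i\<in>I. real k * c ^ k * (\<Sum>X\<in>Pow V. ?w X * (1 / c) ^ card (N i \<inter> X)))"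
    unfolding sum_distrib_left by (rule sum.swap)
  also have "\<dots> = (\<Sum>i\<in>I. real k * (c ^ k * (1 - p + p * (1 / c)) ^ card (N i)))"
    using N expectation_power_card_Int[OF assms(1)] by (intro sum.cong) (simp_all only: mult.assoc)
  also have "\<dots> \<le> (\<Sum>i\<in>I. real k * ?q)"
    using N moment_bound[OF assms(5,6) \<open>m > 0\<close> _ p_def] by (intro sum_mono mult_left_mono) auto
  also have "\<dots> = real k * ?q * real (card I)"
    by (simp only: sum_constant mult.commute)
  also have "(\<Sum>X\<in>Pow V. ?w X * real (card X)) = p * real (card V)"
    by (rule expectation_card[OF assms(1)])
  finally have "(\<Sum>X\<in>Pow V. ?w X * ?h X) \<le> p * real (card V) + real k * ?q * real (card I)"
    by simp
  then have "\<exists>X\<subseteq>V. ?h X \<le> p * real (card V) + real k * ?q * real (card I)"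
    by (rule exists_le_expectation[OF assms(1) p])
  then obtain X where X: "X \<subseteq> V" "?h X \<le> p * real (card V) + real k * ?q * real (card I)"
    by blast
  have N_large: "\<forall>i\<in>I. N i \<subseteq> V \<and> k \<le> card (N i)"
    using N km by auto
  obtain D where D: "D \<subseteq> V" "\<And>i. i \<in> I \<Longrightarrow> k \<le> card (N i \<inter> D)"
    "card D \<le> card X + (\<Sum>i\<in>I. k - card (N i \<inter> X))"
    using exists_repair[OF assms(1,2) X(1) N_large] by blast
  have "(\<Sum>i\<in>I. real (k - card (N i \<inter> X))) < (\<Sum>i\<in>I. real k * c ^ k * (1 / c) ^ card (N i \<inter> X))"
    using assms by (intro sum_strict_mono deficiency_less) auto
  moreover have "real (card D) \<le> real (card X) + (\<Sum>i\<in>I. real (k - card (N i \<inter> X)))"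
    using D(3) by (simp flip: of_nat_sum of_nat_add)
  ultimately have "real (card D) < p * real (card V) + real k * ?q * real (card I)"
    using X(2) by linarith
  then show ?thesis
    using D(1,2) unfolding p_def by blast
qed

lemma tuple_domination_number_le:
  assumes "graph G" "tuple_dominating k G X"
  shows "tuple_domination_number k G \<le> card X"
proof -
  interpret graph G by fact
  have "{card X | X. tuple_dominating k G X} \<subseteq> card ` Pow (verts G)"
    by (auto simp: tuple_dominating_def)
  then have "finite {card X | X. tuple_dominating k G X}"
    by (rule finite_subset) simp
  then show ?thesis
    unfolding tuple_domination_number_def using assms(2) by (intro Min_le) auto
qed

theorem theorem8:
  fixes G :: "('a, 'b) pre_digraph" and k :: nat and c :: real
  assumes "graph G" and "verts G \<noteq> {}"
    and "k \<ge> 1" and "c > 1"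
    and "real (min_degree G) \<ge> c * real k - 1"
  shows "real (tuple_domination_number k G)
    < (c / (real (min_degree G) + 1) + 1 / exp (0.5 * real k * (c + 1 / c - 2)))
        * real k * real (card (verts G))"
proof -
  interpret graph G by fact
  have m: "c * real k \<le> real (min_degree G + 1)"
    using assms(5) by simp
  have nbhd: "\<forall>v\<in>verts G. closed_nbhd G v \<subseteq> verts G
      \<and> min_degree G + 1 \<le> card (closed_nbhd G v)"
    using card_closed_nbhd[OF assms(1)]
    by (auto simp: closed_nbhd_def min_degree_def dest: adj_in_verts)
  obtain D where D: "D \<subseteq> verts G" "\<And>v. v \<in> verts G \<Longrightarrow> k \<le> card (closed_nbhd G v \<inter> D)"
    "real (card D) < c * real k / real (min_degree G + 1) * real (card (verts G))
      + real k * (1 / exp (0.5 * real k * (c + 1 / c - 2))) * real (card (verts G))"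
    using exists_multiple_transversal[OF finite_verts finite_verts assms(2-4) m nbhd] by blast
  have "tuple_dominating k G D"
    using D(1,2) by (simp add: tuple_dominating_def)
  then have "real (tuple_domination_number k G) \<le> real (card D)"
    using tuple_domination_number_le[OF assms(1)] by simp
  also note D(3)
  also have "c * real k / real (min_degree G + 1) * real (card (verts G))
      + real k * (1 / exp (0.5 * real k * (c + 1 / c - 2))) * real (card (verts G))
    = (c / (real (min_degree G) + 1) + 1 / exp (0.5 * real k * (c + 1 / c - 2)))
        * real k * real (card (verts G))"
    by (simp add: algebra_simps)
  finally show ?thesis .
qed

end
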